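(* Let $d\ge1$. Then $$\sum_{\sigma\in \mathcal S_d^D}t^{\mathrm{Wmaj}(\sigma)}=\frac{(1-t)^d+(1+t)^d}{2}\prod_{j=1}^d\frac{1-t^j}{1-t}.$$
   Context: $\mathcal S_d^\pm$ is the group of permutations $\sigma$ of $\{\pm1,\dots,\pm d\}$ with $\sigma(-i)=-\sigma(i)$, and $\mathcal S_d^D$ is its subgroup of those $\sigma$ with $\prod_{i=1}^d\sigma(i)=d!$ (i.e. with an even number of $i\in\{1,\dots,d\}$ such that $\sigma(i)<0$). $\mathrm{Wmaj}(\sigma)=\sum_{1\le i<d,\ \sigma(i)>\sigma(i+1)}i+\#\{1\le i\le d:\sigma(i)<0\}$, using the usual order on integers. *)

theory Defs
  imports Complex_Main "HOL-Combinatorics.Permutations"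
begin

text \<open>Following the library convention for \<open>permutes\<close>, a permutation of
  \<open>{\<plusminus>1, \<dots>, \<plusminus>d}\<close> is represented by a function on all integers that is the identity
  outside this set, so that each permutation has exactly one representative.\<close>

definition signed_perms :: "nat \<Rightarrow> (int \<Rightarrow> int) set" where
  "signed_perms d =
     {\<sigma>. \<sigma> permutes ({- int d..int d} - {0}) \<and>
         (\<forall>i \<in> {- int d..int d} - {0}. \<sigma> (- i) = - \<sigma> i)}"

definition even_signed_perms :: "nat \<Rightarrow> (int \<Rightarrow> int) set" where
  "even_signed_perms d = {\<sigma> \<in> signed_perms d. (\<Prod>i = 1..d. \<sigma> (int i)) = fact d}"

definition Wmaj :: "nat \<Rightarrow> (int \<Rightarrow> int) \<Rightarrow> nat" where
  "Wmaj d \<sigma> =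
     (\<Sum>i \<in> {i. 1 \<le> i \<and> i < d \<and> \<sigma> (int i) > \<sigma> (int (i + 1))}. i)
     + card {i::nat. 1 \<le> i \<and> i \<le> d \<and> \<sigma> (int i) < 0}"

end

theory Submission
  imports Defs "HOL-Combinatorics.Multiset_Permutations"
begin

text \<open>Group the signed permutations by the set \<open>N\<close> of absolute values that carry a minus sign.
  A class consists of all arrangements of a fixed set of \<open>d\<close> integers, so MacMahon's theorem gives
  the major index generating function \<open>[d]\<^sub>t!\<close> on it, whatever \<open>N\<close> is. Hence
  the sum is \<open>[d]\<^sub>t!\<close> times the sum of \<open>t ^ card N\<close> over the subsets \<open>N\<close> of \<open>{1..d}\<close> of even size.
  MacMahon's theorem is proved by refining according to the last letter \<open>x\<close>: the arrangements
  of a set of \<open>n\<close> letters that end in \<open>x\<close> contribute \<open>t ^ k * [n - 1]\<^sub>t!\<close>, where \<open>k\<close> is the number of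
  letters exceeding \<open>x\<close>.\<close>

section \<open>Equidistribution of the major index\<close>

text \<open>The major index of the reversed list, so that \<open>#\<close> appends a last letter.\<close>

fun rmaj :: "'b::linorder list \<Rightarrow> nat" where
  "rmaj [] = 0"
| "rmaj [x] = 0"
| "rmaj (x # y # ys) = rmaj (y # ys) + (if x < y then Suc (length ys) else 0)"

text \<open>The counts of larger elements are \<open>0, ..., card U - 1\<close>, each attained once.
  The induction adds a new minimum \<open>b\<close>, which lies above nothing, so the counts of the
  old elements do not change.\<close>

lemma sum_power_card_greater:
  fixes U :: "'b::linorder set" and t :: "'a::comm_semiring_1"
  assumes "finite U"
  shows "(\<Sum>y\<in>U. t ^ card {v\<in>U. y < v}) = (\<Sum>i<card U. t ^ i)"
  using assms
proof (induction U rule: finite_linorder_min_induct)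
  case empty
  then show ?case by simp
next
  case (insert b A)
  have b: "b \<notin> A" using insert.hyps by auto
  have 1: "{v \<in> insert b A. b < v} = A" using insert.hyps by auto
  have 2: "{v \<in> insert b A. y < v} = {v \<in> A. y < v}" if "y \<in> A" for y
    using insert.hyps that by (auto dest: order.asym)
  have "(\<Sum>y\<in>insert b A. t ^ card {v \<in> insert b A. y < v})
      = t ^ card {v \<in> insert b A. b < v} + (\<Sum>y\<in>A. t ^ card {v \<in> insert b A. y < v})"
    using insert.hyps(1) b by (rule sum.insert)
  also have "(\<Sum>y\<in>A. t ^ card {v \<in> insert b A. y < v}) = (\<Sum>y\<in>A. t ^ card {v \<in> A. y < v})"
    by (intro sum.cong refl) (simp only: 2)
  finally show ?case using insert.hyps b insert.IH
    by (simp only: 1) (simp add: add.commute)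
qed

lemma sum_permutations_of_set_Cons:
  fixes g :: "'b list \<Rightarrow> 'a::comm_monoid_add"
  assumes "finite V" "V \<noteq> {}"
  shows "(\<Sum>xs\<in>permutations_of_set V. g xs)
       = (\<Sum>x\<in>V. \<Sum>xs\<in>permutations_of_set (V - {x}). g (x # xs))"
proof -
  have "(\<Sum>xs\<in>permutations_of_set V. g xs)
      = (\<Sum>x\<in>V. \<Sum>xs\<in>(#) x ` permutations_of_set (V - {x}). g xs)"
    unfolding permutations_of_set_nonempty[OF assms(2)]
    using assms(1) by (intro sum.UNION_disjoint) auto
  then show ?thesis by (simp add: sum.reindex)
qed

text \<open>Induction on the number of letters, splitting by the neighbour \<open>y\<close> of the
  last letter \<open>x\<close>. For \<open>y\<close> below \<open>x\<close> the exponents of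
  \<open>t\<close> start at \<open>card U\<close>; for \<open>y\<close> above \<open>x\<close> the
  new descent at position \<open>card W\<close> makes them start at \<open>card W\<close>. Together
  they fill a run of \<open>card W\<close> consecutive exponents from \<open>card U\<close>
  on.\<close>

lemma sum_power_rmaj_Cons:
  fixes V :: "'b::linorder set" and t :: "'a::comm_semiring_1"
  assumes "finite V" "x \<in> V"
  shows "(\<Sum>xs\<in>permutations_of_set (V - {x}). t ^ rmaj (x # xs))
       = t ^ card {v\<in>V. x < v} * (\<Prod>j = 1..card V - 1. \<Sum>i<j. t ^ i)"
  using assms
proof (induction "card V" arbitrary: V x rule: less_induct)
  case less
  define W where "W = V - {x}"
  define L where "L = {v\<in>V. v < x}"
  define U where "U = {v\<in>V. x < v}"
  have fin: "finite W" "finite L" "finite U" using less.prems by (auto simp: W_def L_def U_def)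
  have W: "W = L \<union> U" "L \<inter> U = {}" by (auto simp: W_def L_def U_def)
  have cW: "card W = card L + card U" "card V - 1 = card W" "card W < card V"
    subgoal using fin W by (simp add: card_Un_disjoint)
    subgoal unfolding W_def using less.prems by simp
    subgoal unfolding W_def using less.prems by (rule card_Diff1_less)
    done
  show ?case
  proof (cases "W = {}")
    case True
    then have "U = {}" "L = {}" using W by auto
    then show ?thesis using True cW(2) unfolding W_def[symmetric] U_def[symmetric] by simp
  next
    case False
    let ?P = "\<Prod>j = 1..card W - 1. \<Sum>i<j. t ^ i"
    have "(\<Sum>xs\<in>permutations_of_set W. t ^ rmaj (x # xs))
        = (\<Sum>y\<in>W. \<Sum>ys\<in>permutations_of_set (W - {y}). t ^ rmaj (x # y # ys))"
      using fin(1) False by (rule sum_permutations_of_set_Cons)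
    also have "\<dots> = (\<Sum>y\<in>W. (if x < y then t ^ card W else 1) *
        (\<Sum>ys\<in>permutations_of_set (W - {y}). t ^ rmaj (y # ys)))"
    proof (rule sum.cong[OF refl])
      fix y assume y: "y \<in> W"
      \<comment> \<open>The position of a descent between \<open>y\<close> and \<open>x\<close> is
        the same for all arrangements, so its weight factors out of the inner sum.\<close>
      have "Suc (length ys) = card W" if "ys \<in> permutations_of_set (W - {y})" for ys
        using that y fin(1) length_finite_permutations_of_set[OF that]
        by (metis card_Suc_Diff1)
      then show "(\<Sum>ys\<in>permutations_of_set (W - {y}). t ^ rmaj (x # y # ys))
        = (if x < y then t ^ card W else 1) *
          (\<Sum>ys\<in>permutations_of_set (W - {y}). t ^ rmaj (y # ys))"
        by (auto simp: sum_distrib_left power_add mult.commute intro!: sum.cong)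
    qed
    also have "\<dots> = (\<Sum>y\<in>W. (if x < y then t ^ card W else 1) * (t ^ card {v\<in>W. y < v} * ?P))"
      using less.hyps[OF cW(3) fin(1)] by (intro sum.cong refl) simp
    also have "\<dots> = (\<Sum>y\<in>L. (if x < y then t ^ card W else 1) * (t ^ card {v\<in>W. y < v} * ?P))
        + (\<Sum>y\<in>U. (if x < y then t ^ card W else 1) * (t ^ card {v\<in>W. y < v} * ?P))"
      unfolding W(1) using fin W(2) by (intro sum.union_disjoint) auto
    \<comment> \<open>All of \<open>U\<close> lies above each \<open>y\<close> in \<open>L\<close>,
      which raises every exponent by \<open>card U\<close>.\<close>
    also have "(\<Sum>y\<in>L. (if x < y then t ^ card W else 1) * (t ^ card {v\<in>W. y < v} * ?P))
        = (\<Sum>y\<in>L. t ^ card {v\<in>L. y < v}) * (t ^ card U * ?P)"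
      unfolding sum_distrib_right
    proof (rule sum.cong[OF refl])
      fix y assume y: "y \<in> L"
      then have "{v\<in>W. y < v} = {v\<in>L. y < v} \<union> U" by (auto simp: W_def L_def U_def)
      moreover have "card ({v\<in>L. y < v} \<union> U) = card {v\<in>L. y < v} + card U"
        using fin W by (intro card_Un_disjoint) auto
      moreover have "\<not> x < y" using y by (auto simp: L_def)
      ultimately show "(if x < y then t ^ card W else 1) * (t ^ card {v\<in>W. y < v} * ?P)
        = t ^ card {v\<in>L. y < v} * (t ^ card U * ?P)"
        by (simp add: power_add mult.assoc)
    qed
    also have "(\<Sum>y\<in>U. (if x < y then t ^ card W else 1) * (t ^ card {v\<in>W. y < v} * ?P))
        = (\<Sum>y\<in>U. t ^ card {v\<in>U. y < v}) * (t ^ card W * ?P)"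
      unfolding sum_distrib_right
    proof (rule sum.cong[OF refl])
      fix y assume y: "y \<in> U"
      then have "{v\<in>W. y < v} = {v\<in>U. y < v}" "x < y" by (auto simp: W_def U_def)
      then show "(if x < y then t ^ card W else 1) * (t ^ card {v\<in>W. y < v} * ?P)
        = t ^ card {v\<in>U. y < v} * (t ^ card W * ?P)"
        by (simp add: mult_ac)
    qed
    \<comment> \<open>The second block of exponents begins at
      \<open>card W = card L + card U\<close>, just where the first one ends.\<close>
    also have "(\<Sum>y\<in>L. t ^ card {v\<in>L. y < v}) * (t ^ card U * ?P)
        + (\<Sum>y\<in>U. t ^ card {v\<in>U. y < v}) * (t ^ card W * ?P)
        = t ^ card U * (((\<Sum>i<card L. t ^ i) + t ^ card L * (\<Sum>i<card U. t ^ i)) * ?P)"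
      using fin by (simp add: sum_power_card_greater cW power_add algebra_simps)
    also have "(\<Sum>i<card L. t ^ i) + t ^ card L * (\<Sum>i<card U. t ^ i) = (\<Sum>i<card W. t ^ i)"
    proof -
      have "(\<Sum>i<l + u. t ^ i) = (\<Sum>i<l. t ^ i) + t ^ l * (\<Sum>i<u. t ^ i)" for l u
        by (induction u) (simp_all add: power_add algebra_simps)
      then show ?thesis by (simp add: cW)
    qed
    also have "(\<Sum>i<card W. t ^ i) * ?P = (\<Prod>j = 1..card W. \<Sum>i<j. t ^ i)"
    proof -
      obtain m where "card W = Suc m" using False fin(1) by (metis card_eq_0_iff not0_implies_Suc)
      then show ?thesis by (simp add: mult.commute)
    qed
    finally show ?thesis by (simp only: cW(2) W_def[symmetric] U_def[symmetric])
  qed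
qed

text \<open>MacMahon's theorem for distinct letters: summing the refined formula over the last
  letter supplies the missing factor \<open>j = card V\<close>.\<close>

theorem sum_power_rmaj:
  fixes V :: "'b::linorder set" and t :: "'a::comm_semiring_1"
  assumes "finite V"
  shows "(\<Sum>xs\<in>permutations_of_set V. t ^ rmaj xs) = (\<Prod>j = 1..card V. \<Sum>i<j. t ^ i)"
proof (cases "V = {}")
  case True
  then show ?thesis by simp
next
  case False
  then obtain m where m: "card V = Suc m"
    using assms by (metis card_eq_0_iff not0_implies_Suc)
  have "(\<Sum>xs\<in>permutations_of_set V. t ^ rmaj xs)
      = (\<Sum>x\<in>V. t ^ card {v\<in>V. x < v} * (\<Prod>j = 1..card V - 1. \<Sum>i<j. t ^ i))"
    using assms False by (simp add: sum_permutations_of_set_Cons sum_power_rmaj_Cons)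
  also have "\<dots> = (\<Sum>i<card V. t ^ i) * (\<Prod>j = 1..card V - 1. \<Sum>i<j. t ^ i)"
    using assms by (simp only: sum_distrib_right[symmetric] sum_power_card_greater)
  finally show ?thesis by (simp add: m mult.commute)
qed

text \<open>Reversal puts the last position at the head, so passing from \<open>n\<close> to
  \<open>n + 1\<close> unfolds \<open>rmaj\<close> once and tests only the descent at
  \<open>n\<close>.\<close>

lemma rmaj_word:
  fixes f :: "nat \<Rightarrow> 'b::linorder"
  shows "rmaj (map f (rev [1..<Suc n])) = (\<Sum>i | 1 \<le> i \<and> i < n \<and> f (i + 1) < f i. i)"
proof (induction n)
  case 0
  then show ?case by simp
next
  case (Suc n)
  let ?D = "\<lambda>n. {i. 1 \<le> i \<and> i < n \<and> f (i + 1) < f i}"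
  show ?case
  \<comment> \<open>A one-letter word has no neighbouring pair, so the recursive equation of
    \<open>rmaj\<close> applies only for positive \<open>n\<close>.\<close>
  proof (cases n)
    case 0
    then have "?D (Suc n) = {}" by auto
    then show ?thesis using 0 by simp
  next
    case (Suc m)
    have D: "?D (Suc n) = (if f (n + 1) < f n then insert n (?D n) else ?D n)"
      using Suc by (auto simp: less_Suc_eq)
    have fin: "finite (?D n)" "n \<notin> ?D n" by auto
    have "rmaj (map f (rev [1..<Suc (Suc n)]))
        = rmaj (map f (rev [1..<Suc n])) + (if f (n + 1) < f n then n else 0)"
      by (simp add: Suc)
    then show ?thesis unfolding Suc.IH D using fin by simp
  qed
qed

section \<open>Signed permutations with prescribed signs\<close>

text \<open>The values taken on \<open>{1..d}\<close> when \<open>N\<close> is the set of absolute values with a minus sign.\<close>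

definition signed_values :: "nat \<Rightarrow> int set \<Rightarrow> int set" where
  "signed_values d N = uminus ` N \<union> ({1..int d} - N)"

definition sign_class :: "nat \<Rightarrow> int set \<Rightarrow> (int \<Rightarrow> int) set" where
  "sign_class d N = {\<sigma> \<in> signed_perms d. \<sigma> ` {1..int d} = signed_values d N}"

text \<open>The value at \<open>d\<close> comes first, to match the reversed convention of
  \<open>rmaj\<close>.\<close>

definition word :: "nat \<Rightarrow> (int \<Rightarrow> int) \<Rightarrow> int list" where
  "word d \<sigma> = map (\<lambda>i. \<sigma> (int i)) (rev [1..<Suc d])"

section \<open>Value sets with a given sign pattern\<close>

lemma mem_signed_values:
  assumes "N \<subseteq> {1..int d}"
  shows "v \<in> signed_values d N \<longleftrightarrow> (if v < 0 then - v \<in> N else v \<in> {1..int d} - N)"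
  using assms by (auto simp: signed_values_def image_iff intro!: bexI[of _ "- v"])

lemma signed_values_negative:
  assumes "N \<subseteq> {1..int d}"
  shows "{v \<in> signed_values d N. v < 0} = uminus ` N"
  using assms by (auto simp: signed_values_def)

lemma finite_signed_values: "N \<subseteq> {1..int d} \<Longrightarrow> finite (signed_values d N)"
  by (auto simp: signed_values_def intro: finite_subset)

lemma card_signed_values:
  assumes "N \<subseteq> {1..int d}"
  shows "card (signed_values d N) = d"
proof -
  have fin: "finite N" using assms finite_subset by blast
  have "card (signed_values d N) = card (uminus ` N) + card ({1..int d} - N)"
    unfolding signed_values_def using assms fin by (intro card_Un_disjoint) auto
  also have "\<dots> = card N + (card {1..int d} - card N)"
    using assms fin by (simp add: card_image card_Diff_subset)
  finally show ?thesis using card_mono[OF _ assms] by simp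
qed

text \<open>Translates the product condition defining \<open>even_signed_perms\<close> into the
  parity of \<open>card N\<close>.\<close>

lemma prod_signed_values:
  assumes "N \<subseteq> {1..int d}"
  shows "\<Prod>(signed_values d N) = (-1) ^ card N * fact d"
proof -
  have fin: "finite N" using assms finite_subset by blast
  have "\<Prod>(signed_values d N) = \<Prod>(uminus ` N) * \<Prod>({1..int d} - N)"
    unfolding signed_values_def using assms fin by (intro prod.union_disjoint) auto
  also have "\<Prod>(uminus ` N) = (\<Prod>v\<in>N. - 1 * v)" by (simp add: prod.reindex)
  also have "\<dots> = (-1) ^ card N * \<Prod>N" by (simp only: prod.distrib prod_constant)
  also have "(-1) ^ card N * \<Prod>N * \<Prod>({1..int d} - N) = (-1) ^ card N * \<Prod>{1..int d}"
    using prod.subset_diff[OF assms, of "\<lambda>v. v"] by (simp add: mult_ac)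
  also have "\<Prod>{1..int d} = fact d"
  proof -
    have "\<Prod>{1..int d} = (\<Prod>i = 1..d. int i)"
      by (rule prod.reindex_bij_witness[of _ int nat]) auto
    then show ?thesis by (simp add: fact_prod)
  qed
  finally show ?thesis .
qed

text \<open>The negative values recover \<open>N\<close>; this makes the sign classes
  disjoint.\<close>

lemma inj_on_signed_values: "inj_on (signed_values d) (Pow {1..int d})"
proof (rule inj_onI)
  fix M N assume "M \<in> Pow {1..int d}" "N \<in> Pow {1..int d}" "signed_values d M = signed_values d N"
  then have "uminus ` M = uminus ` N" by (metis PowD signed_values_negative)
  then show "M = N" by (simp add: inj_image_eq_iff)
qed

section \<open>Signed permutations and their restriction to the positive half\<close>

lemma finite_signed_perms: "finite (signed_perms d)"
  by (rule finite_subset[OF _ finite_permutations[of "{- int d..int d} - {0}"]])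
    (auto simp: signed_perms_def)

lemma signed_perm_inj: "\<sigma> \<in> signed_perms d \<Longrightarrow> inj \<sigma>"
  by (auto simp: signed_perms_def permutes_inj)

lemma signed_perm_minus: "\<sigma> \<in> signed_perms d \<Longrightarrow> i \<in> {1..int d} \<Longrightarrow> \<sigma> (- i) = - \<sigma> i"
  by (auto simp: signed_perms_def)

text \<open>Every signed permutation lies in some sign class: the image of the positive half and its
  negative partition the whole domain, so exactly one of \<open>v\<close> and \<open>- v\<close> is
  attained for each \<open>v\<close> in \<open>{1..int d}\<close>.\<close>

lemma signed_perm_image:
  assumes "\<sigma> \<in> signed_perms d"
  shows "\<exists>N \<subseteq> {1..int d}. \<sigma> ` {1..int d} = signed_values d N"
proof -
  let ?X = "{- int d..int d} - {0}" and ?S = "\<sigma> ` {1..int d}"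
  have im: "\<sigma> ` ?X = ?X" using assms by (auto simp: signed_perms_def permutes_image)
  have X: "?X = {1..int d} \<union> uminus ` {1..int d}"
    by auto
  have "\<sigma> ` uminus ` {1..int d} = uminus ` ?S"
    unfolding image_image by (intro image_cong refl signed_perm_minus[OF assms])
  then have un: "?S \<union> uminus ` ?S = ?X" using im X by (metis image_Un)
  have disj: "- v \<notin> ?S" if "v \<in> ?S" for v
  proof
    assume "- v \<in> ?S"
    with that obtain i j where ij: "i \<in> {1..int d}" "j \<in> {1..int d}" "v = \<sigma> i" "- v = \<sigma> j" by auto
    then have "\<sigma> j = \<sigma> (- i)" using signed_perm_minus[OF assms] by simp
    then have "j = - i" using signed_perm_inj[OF assms] by (simp add: inj_eq)
    then show False using ij by simp
  qed
  \<comment> \<open>The absolute values whose negative is attained on the positive half.\<close>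
  define N where "N = {v \<in> {1..int d}. - v \<in> ?S}"
  have N: "N \<subseteq> {1..int d}" and memN: "\<And>v. v \<in> N \<longleftrightarrow> v \<in> {1..int d} \<and> - v \<in> ?S"
    by (auto simp: N_def)
  have "?S = signed_values d N"
  proof (rule set_eqI)
    fix v
    have "v \<in> uminus ` ?S \<longleftrightarrow> - v \<in> ?S" by (metis imageE imageI minus_minus)
    then have S: "v \<in> ?S \<Longrightarrow> v \<in> ?X" "v \<in> ?X \<Longrightarrow> v \<in> ?S \<or> - v \<in> ?S"
      using un by (metis UnCI, metis UnE)
    show "v \<in> ?S \<longleftrightarrow> v \<in> signed_values d N"
    proof (cases "v < 0")
      case True
      then have "v \<in> signed_values d N \<longleftrightarrow> - v \<in> {1..int d} \<and> v \<in> ?S"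
        by (simp only: mem_signed_values[OF N] memN if_True minus_minus)
      moreover have "v \<in> ?X \<Longrightarrow> - v \<in> {1..int d}" using True by auto
      ultimately show ?thesis using S(1) by blast
    next
      case False
      then have "v \<in> signed_values d N \<longleftrightarrow> v \<in> {1..int d} \<and> - v \<notin> ?S"
        by (simp only: mem_signed_values[OF N] Diff_iff memN if_False) blast
      moreover have "v \<in> ?X \<longleftrightarrow> v \<in> {1..int d}" using False by auto
      ultimately show ?thesis using S disj by metis
    qed
  qed
  then show ?thesis by (intro exI[of _ N]) (use N in auto)
qed

lemma signed_perms_eqI:
  assumes "\<sigma> \<in> signed_perms d" "\<tau> \<in> signed_perms d"
    and "\<And>i. i \<in> {1..int d} \<Longrightarrow> \<sigma> i = \<tau> i"
  shows "\<sigma> = \<tau>"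
proof
  fix i
  consider "i \<in> {1..int d}" | "- i \<in> {1..int d}" | "i \<notin> {- int d..int d} - {0}"
    by (cases i "0::int" rule: linorder_cases) (auto simp: minus_le_iff)
  then show "\<sigma> i = \<tau> i"
  proof cases
    case 1
    then show ?thesis by (rule assms(3))
  next
    case 2
    then show ?thesis
      using signed_perm_minus[OF assms(1) 2] signed_perm_minus[OF assms(2) 2] assms(3)[OF 2] by simp
  next
    case 3
    then have "\<sigma> i = i" "\<tau> i = i"
      using assms(1,2) by (auto simp: signed_perms_def intro: permutes_not_in)
    then show ?thesis by simp
  qed
qed

text \<open>The odd extension of \<open>g\<close>, completed by the identity, is a permutation
  because \<open>signed_values d N\<close> and its negative are disjoint and together exhaust the
  domain.\<close>

lemma extend_to_signed_perm:
  assumes N: "N \<subseteq> {1..int d}" and g: "bij_betw g {1..int d} (signed_values d N)"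
  obtains \<sigma> where "\<sigma> \<in> sign_class d N" "\<And>i. i \<in> {1..int d} \<Longrightarrow> \<sigma> i = g i"
proof -
  let ?X = "{- int d..int d} - {0}" and ?V = "signed_values d N"
  define \<sigma> where
    "\<sigma> i = (if i \<in> {1..int d} then g i else if - i \<in> {1..int d} then - g (- i) else i)" for i
  have pos: "bij_betw \<sigma> {1..int d} ?V"
    using g by (subst bij_betw_cong[of _ _ g]) (auto simp: \<sigma>_def)
  have "bij_betw (uminus \<circ> (g \<circ> uminus)) (uminus ` {1..int d}) (uminus ` ?V)"
  proof (rule bij_betw_trans)
    show "bij_betw (g \<circ> uminus) (uminus ` {1..int d}) ?V"
      by (rule bij_betw_trans[OF _ g]) (auto simp: bij_betw_def inj_on_def image_image)
    show "bij_betw uminus ?V (uminus ` ?V)" by (auto simp: bij_betw_def inj_on_def)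
  qed
  then have neg: "bij_betw \<sigma> (uminus ` {1..int d}) (uminus ` ?V)"
    by (subst bij_betw_cong[of _ _ "uminus \<circ> (g \<circ> uminus)"]) (auto simp: \<sigma>_def)
  have "- v \<notin> ?V" if "v \<in> ?V" for v
    using that N by (auto simp: mem_signed_values split: if_splits)
  then have "?V \<inter> uminus ` ?V = {}" by auto
  then have "bij_betw \<sigma> ({1..int d} \<union> uminus ` {1..int d}) (?V \<union> uminus ` ?V)"
    by (rule bij_betw_combine[OF pos neg])
  moreover have X: "{1..int d} \<union> uminus ` {1..int d} = ?X" by auto
  moreover have "?V \<union> uminus ` ?V = {1..int d} \<union> uminus ` {1..int d}"
  proof -
    have "uminus ` ?V = N \<union> uminus ` ({1..int d} - N)"
      unfolding signed_values_def image_Un image_image by simp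
    then show ?thesis using N unfolding signed_values_def by blast
  qed
  ultimately have "bij_betw \<sigma> ?X ?X" by simp
  then have "\<sigma> permutes ?X" by (rule bij_imp_permutes) (auto simp: \<sigma>_def)
  then have "\<sigma> \<in> signed_perms d" by (auto simp: signed_perms_def \<sigma>_def)
  then have "\<sigma> \<in> sign_class d N" using pos by (auto simp: sign_class_def bij_betw_def)
  then show thesis by (rule that) (simp add: \<sigma>_def)
qed

section \<open>Signed permutations as words\<close>

lemma set_word: "set (word d \<sigma>) = \<sigma> ` {1..int d}"
proof -
  have "{1..int d} = int ` {1..<Suc d}"
    by (simp add: atLeastLessThanSuc_atLeastAtMost image_int_atLeastAtMost)
  then show ?thesis unfolding word_def by (simp add: image_image del: upt_Suc)
qed

text \<open>Injectivity holds since the values on the positive half determine a signed permutation;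
  surjectivity comes from the odd extension.\<close>

lemma bij_betw_word:
  assumes N: "N \<subseteq> {1..int d}"
  shows "bij_betw (word d) (sign_class d N) (permutations_of_set (signed_values d N))"
  unfolding bij_betw_def
proof (intro conjI inj_onI subset_antisym subsetI)
  fix \<sigma> \<tau> assume A: "\<sigma> \<in> sign_class d N" "\<tau> \<in> sign_class d N" "word d \<sigma> = word d \<tau>"
  show "\<sigma> = \<tau>"
  proof (rule signed_perms_eqI)
    fix i assume i: "i \<in> {1..int d}"
    then have "nat i \<in> set (rev [1..<Suc d])" by auto
    then have "\<sigma> (int (nat i)) = \<tau> (int (nat i))"
      using A(3) unfolding word_def map_eq_conv by blast
    then show "\<sigma> i = \<tau> i" using i by simp
  qed (use A in \<open>auto simp: sign_class_def\<close>)
next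
  fix xs assume "xs \<in> word d ` sign_class d N"
  then obtain \<sigma> where \<sigma>: "\<sigma> \<in> sign_class d N" "xs = word d \<sigma>" by auto
  then have inj: "inj \<sigma>" by (auto simp: sign_class_def signed_perm_inj)
  have "inj_on (\<lambda>i. \<sigma> (int i)) A" for A by (rule inj_onI) (simp add: inj_eq[OF inj])
  then have "distinct xs" by (simp add: \<sigma>(2) word_def distinct_map del: upt_Suc)
  moreover have "set xs = signed_values d N" using \<sigma> by (auto simp: set_word sign_class_def)
  ultimately show "xs \<in> permutations_of_set (signed_values d N)" by (simp add: permutations_of_set_def)
next
  fix xs assume xs: "xs \<in> permutations_of_set (signed_values d N)"
  then have len: "length xs = d"
    using length_finite_permutations_of_set[of xs] card_signed_values[OF N] by simp
  have dist: "distinct xs" "set xs = signed_values d N" using xs by (auto simp: permutations_of_set_def)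
  \<comment> \<open>The word is reversed and list indices start at 0, so the value at
    \<open>i\<close> stands at index \<open>d - i\<close>.\<close>
  have "bij_betw ((!) xs \<circ> (\<lambda>i. d - nat i)) {1..int d} (signed_values d N)"
  proof (rule bij_betw_trans)
    show "bij_betw (\<lambda>i. d - nat i) {1..int d} {..<d}"
      by (rule bij_betw_byWitness[of _ "\<lambda>k. int (d - k)"]) auto
    show "bij_betw ((!) xs) {..<d} (signed_values d N)"
      using bij_betw_nth[OF dist(1)] dist(2) len by auto
  qed
  then obtain \<sigma> where \<sigma>: "\<sigma> \<in> sign_class d N"
      "\<And>i. i \<in> {1..int d} \<Longrightarrow> \<sigma> i = ((!) xs \<circ> (\<lambda>i. d - nat i)) i"
    using extend_to_signed_perm[OF N] by metis
  have "word d \<sigma> = xs"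
    by (rule nth_equalityI) (auto simp: word_def len nat_diff_distrib rev_nth \<sigma>(2) simp del: upt_Suc)
  then show "xs \<in> word d ` sign_class d N" using \<sigma>(1) by blast
qed

lemma Wmaj_sign_class:
  assumes N: "N \<subseteq> {1..int d}" and \<sigma>: "\<sigma> \<in> sign_class d N"
  shows "Wmaj d \<sigma> = rmaj (word d \<sigma>) + card N"
proof -
  let ?A = "{i::nat. 1 \<le> i \<and> i \<le> d \<and> \<sigma> (int i) < 0}"
  have inj: "inj \<sigma>" using \<sigma> by (auto simp: sign_class_def signed_perm_inj)
  have "(\<lambda>i. \<sigma> (int i)) ` ?A = {v \<in> \<sigma> ` {1..int d}. v < 0}"
  proof (intro set_eqI iffI)
    fix v assume "v \<in> {v \<in> \<sigma> ` {1..int d}. v < 0}"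
    then obtain i where "i \<in> {1..int d}" "v = \<sigma> i" "v < 0" by auto
    then show "v \<in> (\<lambda>i. \<sigma> (int i)) ` ?A" by (intro image_eqI[of _ _ "nat i"]) auto
  qed auto
  also have "\<dots> = uminus ` N" using signed_values_negative[OF N] \<sigma> by (simp add: sign_class_def)
  finally have "card ((\<lambda>i. \<sigma> (int i)) ` ?A) = card (uminus ` N)" by simp
  moreover have "inj_on (\<lambda>i. \<sigma> (int i)) ?A" by (rule inj_onI) (simp add: inj_eq[OF inj])
  moreover have "inj_on uminus N" by simp
  ultimately have "card ?A = card N" by (metis card_image)
  then show ?thesis unfolding Wmaj_def word_def rmaj_word by simp
qed

lemma sum_power_Wmaj_sign_class:
  fixes t :: "'a::comm_semiring_1"
  assumes N: "N \<subseteq> {1..int d}"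
  shows "(\<Sum>\<sigma>\<in>sign_class d N. t ^ Wmaj d \<sigma>) = t ^ card N * (\<Prod>j = 1..d. \<Sum>i<j. t ^ i)"
proof -
  have "(\<Sum>\<sigma>\<in>sign_class d N. t ^ Wmaj d \<sigma>) = (\<Sum>\<sigma>\<in>sign_class d N. t ^ card N * t ^ rmaj (word d \<sigma>))"
    by (intro sum.cong) (simp_all add: Wmaj_sign_class[OF N] power_add mult.commute)
  also have "\<dots> = t ^ card N * (\<Sum>xs\<in>permutations_of_set (signed_values d N). t ^ rmaj xs)"
    unfolding sum_distrib_left[symmetric]
    by (simp add: sum.reindex_bij_betw[OF bij_betw_word[OF N], of "\<lambda>xs. t ^ rmaj xs"])
  finally show ?thesis by (simp add: sum_power_rmaj finite_signed_values card_signed_values N)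
qed

section \<open>Summation over even sign sets\<close>

text \<open>On a sign class the product of the values is constant, so the class lies entirely inside
  or entirely outside the even subgroup.\<close>

lemma even_signed_perms_eq_UN:
  "even_signed_perms d = (\<Union>N\<in>{N \<in> Pow {1..int d}. even (card N)}. sign_class d N)"
proof -
  have *: "\<sigma> \<in> even_signed_perms d \<longleftrightarrow> even (card N)"
    if N: "N \<subseteq> {1..int d}" and \<sigma>: "\<sigma> \<in> sign_class d N" for N \<sigma>
  proof -
    have \<sigma>': "\<sigma> \<in> signed_perms d" "\<sigma> ` {1..int d} = signed_values d N"
      using \<sigma> by (auto simp: sign_class_def)
    have "(\<Prod>i = 1..d. \<sigma> (int i)) = (\<Prod>i\<in>{1..int d}. \<sigma> i)"
      by (rule prod.reindex_bij_witness[of _ nat int]) auto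
    also have "\<dots> = \<Prod>(\<sigma> ` {1..int d})"
      using signed_perm_inj[OF \<sigma>'(1)] by (subst prod.reindex) (auto intro: inj_on_subset)
    also have "\<dots> = (-1) ^ card N * fact d" using \<sigma>'(2) prod_signed_values[OF N] by simp
    \<comment> \<open>For odd \<open>card N\<close> the product is \<open>- fact d\<close>, which
      differs from \<open>fact d\<close> since the factorial is nonzero.\<close>
    finally show ?thesis using \<sigma>'(1) by (cases "even (card N)") (auto simp: even_signed_perms_def)
  qed
  show ?thesis
  proof (intro set_eqI iffI)
    fix \<sigma> assume \<sigma>: "\<sigma> \<in> even_signed_perms d"
    then have "\<sigma> \<in> signed_perms d" by (simp add: even_signed_perms_def)
    moreover from signed_perm_image[OF this] obtain N
      where "N \<subseteq> {1..int d}" "\<sigma> ` {1..int d} = signed_values d N" by auto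
    ultimately have "N \<subseteq> {1..int d}" "\<sigma> \<in> sign_class d N" by (simp_all add: sign_class_def)
    then show "\<sigma> \<in> (\<Union>N\<in>{N \<in> Pow {1..int d}. even (card N)}. sign_class d N)"
      using * \<sigma> by auto
  qed (use * in auto)
qed

lemma sum_Pow_power_card:
  fixes t :: "'a::comm_semiring_1"
  assumes "finite A"
  shows "(\<Sum>N\<in>Pow A. t ^ card N) = (1 + t) ^ card A"
  using assms
proof (induction A rule: finite_induct)
  case empty
  then show ?case by simp
next
  case (insert x A)
  have "(\<Sum>N\<in>Pow (insert x A). t ^ card N)
      = (\<Sum>N\<in>Pow A. t ^ card N) + (\<Sum>N\<in>insert x ` Pow A. t ^ card N)"
    unfolding Pow_insert using insert.hyps by (intro sum.union_disjoint) auto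
  also have "(\<Sum>N\<in>insert x ` Pow A. t ^ card N) = (\<Sum>N\<in>Pow A. t ^ card (insert x N))"
    using insert.hyps by (subst sum.reindex) (auto simp: inj_on_def)
  also have "\<dots> = (\<Sum>N\<in>Pow A. t * t ^ card N)"
  proof (rule sum.cong[OF refl])
    fix N assume "N \<in> Pow A"
    then have "finite N" "x \<notin> N" using insert.hyps by (auto intro: finite_subset)
    then show "t ^ card (insert x N) = t * t ^ card N" by simp
  qed
  finally show ?case using insert by (simp add: sum_distrib_left[symmetric] algebra_simps)
qed

text \<open>Parity filter: \<open>(- t) ^ k + t ^ k\<close> is \<open>2 * t ^ k\<close> for even
  \<open>k\<close> and vanishes for odd \<open>k\<close>.\<close>

lemma sum_even_subsets_power_card:
  fixes t :: "'a::field"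
  assumes "finite A" "(2::'a) \<noteq> 0"
  shows "(\<Sum>N\<in>{N \<in> Pow A. even (card N)}. t ^ card N) = ((1 - t) ^ card A + (1 + t) ^ card A) / 2"
proof -
  have "2 * (\<Sum>N\<in>{N \<in> Pow A. even (card N)}. t ^ card N)
      = (\<Sum>N\<in>Pow A. if even (card N) then 2 * t ^ card N else 0)"
    using assms(1) by (subst sum.inter_filter) (auto simp: sum_distrib_left intro!: sum.cong)
  also have "\<dots> = (\<Sum>N\<in>Pow A. (- t) ^ card N + t ^ card N)"
    by (intro sum.cong) auto
  also have "\<dots> = (1 - t) ^ card A + (1 + t) ^ card A"
    using sum_Pow_power_card[OF assms(1), of "- t"] sum_Pow_power_card[OF assms(1), of t]
    by (simp add: sum.distrib)
  finally show ?thesis using assms(2) by (simp add: field_simps)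
qed

theorem theorem4p1:
  fixes d :: nat and t :: "'a::field"
  assumes "d \<ge> 1" and "(2::'a) \<noteq> 0" and "t \<noteq> 1"
  shows "(\<Sum>\<sigma> \<in> even_signed_perms d. t ^ Wmaj d \<sigma>) =
         ((1 - t) ^ d + (1 + t) ^ d) / 2 * (\<Prod>j = 1..d. (1 - t ^ j) / (1 - t))"
proof -
  let ?E = "{N \<in> Pow {1..int d}. even (card N)}"
  have "(\<Sum>\<sigma> \<in> even_signed_perms d. t ^ Wmaj d \<sigma>) = (\<Sum>N\<in>?E. \<Sum>\<sigma>\<in>sign_class d N. t ^ Wmaj d \<sigma>)"
    unfolding even_signed_perms_eq_UN
  proof (rule sum.UNION_disjoint)
    show "finite ?E" by simp
    show "\<forall>N\<in>?E. finite (sign_class d N)"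
      using finite_signed_perms by (auto simp: sign_class_def)
    show "\<forall>M\<in>?E. \<forall>N\<in>?E. M \<noteq> N \<longrightarrow> sign_class d M \<inter> sign_class d N = {}"
    proof (intro ballI impI equals0I)
      fix M N \<sigma> assume "M \<in> ?E" "N \<in> ?E" "M \<noteq> N" "\<sigma> \<in> sign_class d M \<inter> sign_class d N"
      then show False
        using inj_onD[OF inj_on_signed_values, of d M N] by (auto simp: sign_class_def)
    qed
  qed
  also have "\<dots> = (\<Sum>N\<in>?E. t ^ card N * (\<Prod>j = 1..d. \<Sum>i<j. t ^ i))"
    by (intro sum.cong) (auto simp: sum_power_Wmaj_sign_class)
  also have "\<dots> = ((1 - t) ^ d + (1 + t) ^ d) / 2 * (\<Prod>j = 1..d. \<Sum>i<j. t ^ i)"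
    using sum_even_subsets_power_card[OF _ assms(2), of "{1..int d}" t]
    by (simp only: sum_distrib_right[symmetric]) simp
  \<comment> \<open>Each factor is a finite geometric sum, put in closed form using
    \<open>t \<noteq> 1\<close>.\<close>
  also have "(\<Prod>j = 1..d. \<Sum>i<j. t ^ i) = (\<Prod>j = 1..d. (1 - t ^ j) / (1 - t))"
    using assms(3) by (simp add: sum_gp_strict)
  finally show ?thesis .
qed

end
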